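(* Let $d\ge1$, let $H$ be a Hermitian operator on $\mathbb C^d$, $t\in\mathbb R$, $m\ge1$ an integer, and $U(\tau)=\exp(-iH\tau)$. Assume $\mathrm{Tr}[U(t/m)]\ne0$. Put $\gamma=\mathrm{Tr}[U(t/m)]/d$, $a_{U(t/m)}=|\gamma|$, let $\varphi_{U(t/m)}$ be a real number with $e^{i\varphi_{U(t/m)}}=\overline{\gamma}/a_{U(t/m)}$, and let $U^{[m]}(t)=e^{im\varphi_{U(t/m)}}U(t)$. Then $$\left\|\Gamma_{U(t/m)}^m-\mathcal C_{U^{[m]}(t)}\right\|_\diamond = 1-a_{U(t/m)}^m ,$$ where $\Gamma_{U(t/m)}^m$ is the $m$-fold composition of the pseudo-controllization map $\Gamma_{U(t/m)}$ and $\mathcal C_{V}$ is conjugation by the controlled-$V$ gate (both defined in the context).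
   Context: Let $\mathcal H_c=\mathbb C^2$ (control), $\mathcal H_t=\mathbb C^d$ (target), $\mathcal H_a=\mathbb C^d$ (ancilla). For a unitary $V$ on $\mathbb C^d$: $C_V=|0\rangle\langle0|\otimes\mathbb I_d+|1\rangle\langle1|\otimes V$ on $\mathcal H_c\otimes\mathcal H_t$ and $\mathcal C_V[\rho]=C_V\rho C_V^\dagger$. The controlled swap $C_S$ on $\mathcal H_c\otimes\mathcal H_t\otimes\mathcal H_a$ is the linear map with $C_S|0\rangle|\psi\rangle|\phi\rangle=|0\rangle|\phi\rangle|\psi\rangle$ and $C_S|1\rangle|\psi\rangle|\phi\rangle=|1\rangle|\psi\rangle|\phi\rangle$. Let $W_U=C_S(\mathbb I_2\otimes U\otimes\mathbb I_d)C_S$ and $$\Gamma_U[\rho]=\mathrm{Tr}_{\mathcal H_a}\!\left[W_U(\rho\otimes\mathbb I_d/d)W_U^\dagger\right]$$ for operators $\rho$ on $\mathcal H_c\otimes\mathcal H_t$. The diamond norm of a superoperator $\mathcal S$ on operators on a finite-dimensional Hilbert space $\mathcal H$ is $\|\mathcal S\|_\diamond=\max\{\|(\mathcal S\otimes\mathrm{id}_{\mathcal H})[A]\|_{\mathrm{tr}}: A \text{ an operator on }\mathcal H\otimes\mathcal H,\ \|A\|_{\mathrm{tr}}=1\}$, where $\mathrm{id}_{\mathcal H}$ is the identity superoperator on operators on $\mathcal H$ and $\|A\|_{\mathrm{tr}}=\mathrm{Tr}\sqrt{AA^\dagger}$. *)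

theory Defs
  imports "HOL-Analysis.Analysis"
begin

text \<open>Operators on \<open>\<complex>\<close>-spaces with orthonormal basis indexed by a finite type \<open>'n\<close> are matrices
  \<open>complex^'n^'n\<close>; a tensor product of spaces is indexed by the product type.\<close>

definition madj :: "complex^'n^'m \<Rightarrow> complex^'m^'n" where
  "madj A = (\<chi> i j. cnj (A $ j $ i))"

definition mscale :: "complex \<Rightarrow> complex^'n^'m \<Rightarrow> complex^'n^'m"  (infixr "*\<^sub>M" 75) where
  "c *\<^sub>M A = (\<chi> i j. c * A $ i $ j)"

definition hermitian :: "complex^'n^'n \<Rightarrow> bool" where
  "hermitian A \<longleftrightarrow> madj A = A"

primrec mpow :: "complex^'n^'n \<Rightarrow> nat \<Rightarrow> complex^'n^'n" where
  "mpow A 0 = mat 1"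
| "mpow A (Suc k) = A ** mpow A k"

definition mexp :: "complex^'n^'n \<Rightarrow> complex^'n^'n" where
  "mexp A = (\<Sum>k. (1 / fact k) *\<^sub>R mpow A k)"

definition psd :: "complex^'n^'n \<Rightarrow> bool" where
  "psd A \<longleftrightarrow> hermitian A \<and> (\<forall>v. 0 \<le> Re (\<Sum>i\<in>UNIV. cnj (v $ i) * (A *v v) $ i))"

text \<open>Meaningful for positive semidefinite \<open>A\<close>, where the square root exists and is unique.\<close>

definition msqrt :: "complex^'n^'n \<Rightarrow> complex^'n^'n" where
  "msqrt A = (THE B. psd B \<and> B ** B = A)"

text \<open>The trace below is that of a positive semidefinite matrix, hence real; \<open>Re\<close> only changes
  the type.\<close>

definition trace_norm :: "complex^'n^'n \<Rightarrow> real" where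
  "trace_norm A = Re (trace (msqrt (A ** madj A)))"

definition vtensor :: "complex^'a \<Rightarrow> complex^'b \<Rightarrow> complex^('a::finite \<times> 'b::finite)"  (infixl "\<otimes>\<^sub>v" 72) where
  "v \<otimes>\<^sub>v w = (\<chi> p. v $ fst p * w $ snd p)"

definition mtensor ::
  "complex^'a^'a \<Rightarrow> complex^'b^'b \<Rightarrow> complex^('a::finite \<times> 'b::finite)^('a::finite \<times> 'b::finite)"  (infixl "\<otimes>\<^sub>M" 72) where
  "A \<otimes>\<^sub>M B = (\<chi> p q. A $ fst p $ fst q * B $ snd p $ snd q)"

lemma mtensor_mult_vtensor:
  fixes A :: "complex^'a^'a" and B :: "complex^'b^'b"
  shows "(A \<otimes>\<^sub>M B) *v (v \<otimes>\<^sub>v w) = (A *v v) \<otimes>\<^sub>v (B *v w)"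
proof -
  have "(\<Sum>q\<in>UNIV. A $ i $ fst q * B $ j $ snd q * (v $ fst q * w $ snd q)) =
      (\<Sum>k\<in>UNIV. A $ i $ k * v $ k) * (\<Sum>l\<in>UNIV. B $ j $ l * w $ l)" for i j
    unfolding sum_product UNIV_Times_UNIV [symmetric] sum.cartesian_product
    by (rule sum.cong) (auto simp: mult_ac)
  then show ?thesis
    by (simp add: vec_eq_iff mtensor_def vtensor_def matrix_vector_mult_def)
qed

definition ptrace :: "complex^('a::finite \<times> 'b::finite)^('a::finite \<times> 'b::finite) \<Rightarrow> complex^'a^'a" where
  "ptrace M = (\<chi> i j. \<Sum>k\<in>UNIV. M $ (i, k) $ (j, k))"

text \<open>\<open>S \<otimes> id\<close> acts on a block matrix by applying \<open>S\<close> to every block; the lemma after the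
  definition is the characteristic property of the tensor product of linear maps.\<close>

definition superop_tensor_id ::
  "(complex^'h^'h \<Rightarrow> complex^'h^'h) \<Rightarrow> complex^('h::finite \<times> 'k::finite)^('h::finite \<times> 'k::finite) \<Rightarrow> complex^('h::finite \<times> 'k::finite)^('h::finite \<times> 'k::finite)"
  where
  "superop_tensor_id S A =
     (\<chi> p q. S (\<chi> i j. A $ (i, snd p) $ (j, snd q)) $ fst p $ fst q)"

lemma superop_tensor_id_mtensor:
  assumes "\<And>c X. S (c *\<^sub>M X) = c *\<^sub>M S X"
  shows "superop_tensor_id S (X \<otimes>\<^sub>M Y) = S X \<otimes>\<^sub>M Y"
proof -
  have "(\<chi> i j. (X \<otimes>\<^sub>M Y) $ (i, k) $ (j, l)) = (Y $ k $ l) *\<^sub>M X" for k l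
    by (simp add: vec_eq_iff mtensor_def mscale_def mult.commute)
  then show ?thesis
    unfolding superop_tensor_id_def by (simp only: assms) (simp add: vec_eq_iff mtensor_def mscale_def mult.commute)
qed

lemma superop_tensor_id_add:
  assumes "\<And>X Y. S (X + Y) = S X + S Y"
  shows "superop_tensor_id S (A + B) = superop_tensor_id S A + superop_tensor_id S B"
proof -
  have "(\<chi> i j. (A + B) $ (i, k) $ (j, l)) =
      (\<chi> i j. A $ (i, k) $ (j, l)) + (\<chi> i j. B $ (i, k) $ (j, l))" for k l
    by (simp add: vec_eq_iff)
  then show ?thesis
    unfolding superop_tensor_id_def by (simp only: assms) (simp add: vec_eq_iff)
qed

text \<open>\<open>GREATEST\<close> denotes an attained maximum; it is unspecified if there is none.\<close>

definition diamond_norm :: "(complex^'h^'h \<Rightarrow> complex^'h^'h) \<Rightarrow> real" where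
  "diamond_norm S =
     (GREATEST x. \<exists>A :: complex^('h::finite \<times> 'h::finite)^('h::finite \<times> 'h::finite).
        trace_norm A = 1 \<and> x = trace_norm (superop_tensor_id S A))"

text \<open>The control qubit is indexed by the numeral type \<open>2\<close>, whose two elements are \<open>0\<close> and \<open>1\<close>.\<close>

definition ket :: "'n \<Rightarrow> complex^'n" where
  "ket k = axis k 1"

definition proj :: "'n \<Rightarrow> complex^'n^'n" where
  "proj k = (\<chi> i j. if i = k \<and> j = k then 1 else 0)"

definition ctrl :: "complex^'d^'d \<Rightarrow> complex^(2 \<times> 'd::finite)^(2 \<times> 'd::finite)" where
  "ctrl V = proj 0 \<otimes>\<^sub>M mat 1 + proj 1 \<otimes>\<^sub>M V"

definition ctrl_conj ::
  "complex^'d^'d \<Rightarrow> complex^(2 \<times> 'd::finite)^(2 \<times> 'd::finite) \<Rightarrow> complex^(2 \<times> 'd::finite)^(2 \<times> 'd::finite)" where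
  "ctrl_conj V \<rho> = ctrl V ** \<rho> ** madj (ctrl V)"

definition cswap :: "complex^((2 \<times> 'd::finite) \<times> 'd::finite)^((2 \<times> 'd::finite) \<times> 'd::finite)" where
  "cswap = (\<chi> p q. case p of ((c, i), j) \<Rightarrow> case q of ((c', i'), j') \<Rightarrow>
     if c = c' \<and> (if c = 0 then i = j' \<and> j = i' else i = i' \<and> j = j') then 1 else 0)"

lemma cswap_ket:
  fixes \<psi> \<phi> :: "complex^'d"
  shows "cswap *v (ket 0 \<otimes>\<^sub>v \<psi> \<otimes>\<^sub>v \<phi>) = ket 0 \<otimes>\<^sub>v \<phi> \<otimes>\<^sub>v \<psi>"
    and "cswap *v (ket 1 \<otimes>\<^sub>v \<psi> \<otimes>\<^sub>v \<phi>) = ket 1 \<otimes>\<^sub>v \<psi> \<otimes>\<^sub>v \<phi>"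
proof -
  have row: "(cswap *v v) $ ((c, i), j) = (if c = 0 then v $ ((c, j), i) else v $ ((c, i), j))"
    for v :: "complex^((2 \<times> 'd::finite) \<times> 'd::finite)" and c i j
  proof -
    define r where "r = (if c = 0 then ((c, j), i) else ((c, i), j))"
    have "(cswap :: complex^((2 \<times> 'd) \<times> 'd)^((2 \<times> 'd) \<times> 'd)) $ ((c, i), j) $ q =
        (if q = r then 1 else 0)" for q
      by (cases q rule: prod.exhaust, rename_tac p l, case_tac p) (simp add: cswap_def r_def, metis)
    then have "(cswap *v v) $ ((c, i), j) = (\<Sum>q\<in>UNIV. if q = r then v $ q else 0)"
      unfolding matrix_vector_mult_def vec_lambda_beta by (intro sum.cong) simp_all
    also have "\<dots> = v $ r"
      by (simp only: sum.delta finite UNIV_I if_True)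
    finally show ?thesis
      by (simp only: r_def if_distrib)
  qed
  show "cswap *v (ket 0 \<otimes>\<^sub>v \<psi> \<otimes>\<^sub>v \<phi>) = ket 0 \<otimes>\<^sub>v \<phi> \<otimes>\<^sub>v \<psi>"
    and "cswap *v (ket 1 \<otimes>\<^sub>v \<psi> \<otimes>\<^sub>v \<phi>) = ket 1 \<otimes>\<^sub>v \<psi> \<otimes>\<^sub>v \<phi>"
    unfolding vec_eq_iff split_paired_All row
    by (simp_all add: vtensor_def ket_def axis_def)
qed

definition W_gate :: "complex^'d^'d \<Rightarrow> complex^((2 \<times> 'd::finite) \<times> 'd::finite)^((2 \<times> 'd::finite) \<times> 'd::finite)" where
  "W_gate U = cswap ** (mat 1 \<otimes>\<^sub>M U \<otimes>\<^sub>M mat 1) ** cswap"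

text \<open>The scalar matrix below is the maximally mixed ancilla state \<open>I/d\<close>.\<close>

definition pseudo_ctrl ::
  "complex^'d^'d \<Rightarrow> complex^(2 \<times> 'd::finite)^(2 \<times> 'd::finite) \<Rightarrow> complex^(2 \<times> 'd::finite)^(2 \<times> 'd::finite)" where
  "pseudo_ctrl U \<rho> =
     ptrace (W_gate U ** (\<rho> \<otimes>\<^sub>M mat (1 / of_nat CARD('d))) ** madj (W_gate U))"

end

theory Submission
  imports Defs
begin

text \<open>
  Absorbing the phase of \<open>Tr U\<close> into \<open>V = e\<^sup>i\<^sup>\<phi> U\<close>, the map \<open>\<Gamma>\<^sub>U\<close> is the mixture of the conjugations by
  controlled \<open>V\<close> and controlled \<open>- V\<close> with weights \<open>(1 + a) / 2\<close> and \<open>(1 - a) / 2\<close>. Controlled gates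
  multiply, so \<open>\<Gamma>\<^sub>U\<^sup>m\<close> is the same mixture for \<open>V\<^sup>m\<close> and \<open>a\<^sup>m\<close>, and its difference from the ideal gate
  is \<open>(1 - a\<^sup>m) / 2\<close> times a difference of two unitary conjugations. Since the trace norm of \<open>A\<close> is the
  maximum of \<open>|Tr (C A)|\<close> over contractions \<open>C\<close>, the diamond norm is at most \<open>1 - a\<^sup>m\<close>; a matrix
  unit that is off-diagonal in the control qubit attains this value, because the two conjugations
  have opposite signs on it.
\<close>

subsection \<open>Spectral theorem\<close>

text \<open>Hermitian inner product, antilinear in the first slot. Its real part is the Euclidean
  \<open>inner\<close>, so real-linear tools such as \<open>dim\<close> and
  \<open>orthogonal\<close> stay applicable.\<close>

definition cinner :: "complex^'n \<Rightarrow> complex^'n \<Rightarrow> complex" where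
  "cinner x y = (\<Sum>i\<in>UNIV. cnj (x $ i) * y $ i)"

lemma Re_cinner: "Re (cinner x y) = inner x y"
  by (simp add: cinner_def inner_vec_def inner_complex_def)

lemma cinner_same: "cinner x x = of_real ((norm x)\<^sup>2)"
proof -
  have "Im (cinner x x) = 0" by (simp add: cinner_def)
  then show ?thesis
    by (simp add: complex_eq_iff Re_cinner dot_square_norm)
qed

lemma cinner_cnj: "cinner y x = cnj (cinner x y)"
  by (simp add: cinner_def mult.commute)

lemma cinner_add_right: "cinner x (y + z) = cinner x y + cinner x z"
  by (simp add: cinner_def algebra_simps sum.distrib)

lemma cinner_diff_right: "cinner x (y - z) = cinner x y - cinner x z"
  by (simp add: cinner_def algebra_simps sum_subtractf)

lemma cinner_scaleR_right: "cinner x (r *\<^sub>R y) = of_real r * cinner x y"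
  by (simp add: cinner_def sum_distrib_left scaleR_conv_of_real[where 'a=complex] algebra_simps)

lemma cinner_scale_left: "cinner (c *s x) y = cnj c * cinner x y"
  by (simp add: cinner_def sum_distrib_left algebra_simps)

lemma cinner_zero_right [simp]: "cinner x 0 = 0"
  by (simp add: cinner_def)

lemma cinner_Cauchy_Schwarz: "cmod (cinner x y) \<le> norm x * norm y"
proof -
  have "cmod (cinner x y) \<le> (\<Sum>i\<in>UNIV. cmod (x $ i) * cmod (y $ i))"
    unfolding cinner_def by (rule order_trans[OF norm_sum]) (simp add: norm_mult)
  also have "\<dots> \<le> norm x * norm y"
    using L2_set_mult_ineq[of "\<lambda>i. cmod (x $ i)" "\<lambda>i. cmod (y $ i)" UNIV]
    by (simp add: norm_vec_def)
  finally show ?thesis .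
qed

lemma cinner_adjoint: "cinner x (A *v y) = cinner (madj A *v x) y"
proof -
  have "cinner x (A *v y) = (\<Sum>i\<in>UNIV. \<Sum>j\<in>UNIV. cnj (x $ i) * (A $ i $ j * y $ j))"
    by (simp add: cinner_def matrix_vector_mult_def sum_distrib_left)
  also have "\<dots> = (\<Sum>j\<in>UNIV. \<Sum>i\<in>UNIV. cnj (x $ i) * (A $ i $ j * y $ j))"
    by (rule sum.swap)
  also have "\<dots> = cinner (madj A *v x) y"
    by (simp add: cinner_def matrix_vector_mult_def madj_def sum_distrib_right sum_distrib_left algebra_simps)
  finally show ?thesis .
qed

lemma madj_madj [simp]: "madj (madj A) = A"
  by (simp add: madj_def vec_eq_iff)

lemma madj_mat_1 [simp]: "madj (mat 1) = mat 1"
  by (simp add: madj_def vec_eq_iff mat_def)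

lemma madj_mult: "madj (A ** B) = madj B ** madj A"
  by (simp add: madj_def vec_eq_iff matrix_matrix_mult_def mult.commute)

lemma madj_add: "madj (A + B) = madj A + madj B"
  by (simp add: madj_def vec_eq_iff)

lemma madj_mscale: "madj (c *\<^sub>M A) = cnj c *\<^sub>M madj A"
  by (simp add: madj_def vec_eq_iff mscale_def)

text \<open>Induction on a set of indices: a proper subset of the index type always leaves room for
  one more eigenvector, and \<open>S = UNIV\<close> gives a full orthonormal basis.\<close>

lemma orthonormal_eigenvectors:
  fixes A :: "complex^'n^'n" and S :: "'n set"
  assumes "hermitian A"
  shows "\<exists>(u :: 'n \<Rightarrow> complex^'n) (d :: 'n \<Rightarrow> real).
    \<forall>i\<in>S. A *v u i = d i *\<^sub>R u i \<and> (\<forall>j\<in>S. cinner (u i) (u j) = (if i = j then 1 else 0))"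
proof (induction S rule: finite_induct[OF finite])
  case 1
  then show ?case by simp
next
  case (2 k S)
  then obtain u :: "'n \<Rightarrow> complex^'n" and d :: "'n \<Rightarrow> real"
    where eig: "\<And>i. i \<in> S \<Longrightarrow> A *v u i = d i *\<^sub>R u i"
      and on: "\<And>i j. i \<in> S \<Longrightarrow> j \<in> S \<Longrightarrow> cinner (u i) (u j) = (if i = j then 1 else 0)"
    by blast
  have selfadj: "cinner x (A *v y) = cinner (A *v x) y" for x y
    using assms by (simp add: cinner_adjoint hermitian_def)
  \<comment> \<open>A maximiser of the Rayleigh quotient on the orthogonal complement \<open>T\<close> of the eigenvectors
    found so far is a further eigenvector.\<close>
  define T where "T = {v. \<forall>j\<in>S. cinner (u j) v = 0}"
  define g where "g v = inner v (A *v v)" for v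
  have T_add: "x + y \<in> T" "x - y \<in> T" if "x \<in> T" "y \<in> T" for x y
    using that by (auto simp: T_def cinner_add_right cinner_diff_right)
  have T_scale: "r *\<^sub>R x \<in> T" and T_inv: "A *v x \<in> T" if "x \<in> T" for x r
    using that by (auto simp: T_def cinner_scaleR_right selfadj eig)
      (metis cinner_cnj cinner_scaleR_right complex_cnj_zero_iff mult_zero_right)
  \<comment> \<open>Complex orthogonality to \<open>u j\<close> is real orthogonality to \<open>u j\<close> and \<open>\<i> u j\<close>.\<close>
  define X where "X = u ` S \<union> (\<lambda>j. \<i> *s u j) ` S"
  have "card X \<le> card S + card S"
    unfolding X_def by (rule order_trans[OF card_Un_le]) (intro add_mono card_image_le 2)
  moreover have "card S < CARD('n)"
    using 2 by (metis finite psubset_card_mono UNIV_I psubsetI subset_UNIV)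
  \<comment> \<open>The real dimension is \<open>2 * CARD('n)\<close>, while \<open>X\<close> has at
    most two vectors per index in \<open>S\<close>, so some nonzero vector is orthogonal to all of
    \<open>X\<close>.\<close>
  ultimately have "card X < DIM(complex^'n)" by simp
  moreover have "dim X \<le> card X"
    by (rule dim_le_card') (simp add: X_def)
  ultimately obtain x where x: "x \<noteq> 0" "\<And>y. y \<in> span X \<Longrightarrow> orthogonal x y"
    using orthogonal_to_subspace_exists[of X] by auto
  have "x \<in> T"
    unfolding T_def
  proof clarify
    fix j assume j: "j \<in> S"
    have "inner (u j) x = 0" "inner (\<i> *s u j) x = 0"
      using j x(2)[of "u j"] x(2)[of "\<i> *s u j"]
      by (auto simp: X_def orthogonal_def inner_commute intro: span_base)
    then show "cinner (u j) x = 0"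
      by (simp add: Re_cinner[symmetric] cinner_scale_left complex_eq_iff)
  qed
  have "closed T"
  proof -
    have "T = (\<Inter>j\<in>S. {v. cinner (u j) v = 0})" by (auto simp: T_def)
    also have "closed \<dots>"
      unfolding cinner_def by (intro closed_INT ballI closed_Collect_eq continuous_intros)
    finally show ?thesis .
  qed
  then have "compact (sphere 0 1 \<inter> T)" by (intro compact_Int_closed) auto
  moreover have "(1 / norm x) *\<^sub>R x \<in> sphere 0 1 \<inter> T" using x \<open>x \<in> T\<close> T_scale by auto
  moreover have "continuous_on (sphere 0 1 \<inter> T) g"
    unfolding g_def by (intro continuous_intros linear_continuous_on) 
      (rule linear_linear[THEN iffD2], rule matrix_vector_mul_linear)
  ultimately obtain v where v: "v \<in> sphere 0 1" "v \<in> T"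
    and max: "\<And>y. y \<in> sphere 0 1 \<inter> T \<Longrightarrow> g y \<le> g v"
    by (metis (no_types, lifting) IntE continuous_attains_sup empty_iff)
  define l where "l = g v"
  \<comment> \<open>Homogeneity of degree two extends the bound from the unit sphere to all of
    \<open>T\<close>.\<close>
  have le: "g w \<le> l * (norm w)\<^sup>2" if "w \<in> T" for w
  proof (cases "w = 0")
    case False
    then have "g ((1 / norm w) *\<^sub>R w) \<le> l"
      unfolding l_def using that T_scale by (intro max) auto
    moreover have "g ((1 / norm w) *\<^sub>R w) = g w / (norm w)\<^sup>2"
      by (simp add: g_def linear_scale[OF matrix_vector_mul_linear] power2_eq_square)
    ultimately show ?thesis using False by (simp add: field_simps)
  qed (simp add: g_def)
  define w where "w = A *v v - l *\<^sub>R v"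
  have wT: "w \<in> T" unfolding w_def by (intro T_add T_scale T_inv v)
  define b where "b = (norm w)\<^sup>2"
  define c where "c = l * b - g w"
  have c0: "c \<ge> 0" using le[OF wT] by (simp add: c_def b_def)
  \<comment> \<open>Perturbing the maximiser \<open>v\<close> in the direction of its residual
    \<open>w\<close>: the terms in \<open>inner w v\<close> cancel, leaving a first-order gain
    \<open>2 * t * b\<close> that a second-order term must dominate for every
    \<open>t\<close>.\<close>
  have quad: "2 * t * b \<le> t\<^sup>2 * c" for t
  proof -
    have "g (v + t *\<^sub>R w) \<le> l * (norm (v + t *\<^sub>R w))\<^sup>2" by (intro le T_add T_scale v wT)
    moreover have "inner v (A *v w) = inner w (A *v v)"
      by (metis Re_cinner selfadj inner_commute)
    then have "g (v + t *\<^sub>R w) = l + 2 * t * inner w (A *v v) + t\<^sup>2 * g w"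
      by (simp add: g_def l_def inner_simps linear_add[OF matrix_vector_mul_linear]
          linear_scale[OF matrix_vector_mul_linear] power2_eq_square algebra_simps)
    moreover have "(norm (v + t *\<^sub>R w))\<^sup>2 = 1 + 2 * t * inner w v + t\<^sup>2 * b"
      unfolding b_def power2_norm_eq_inner using v(1)
      by (simp add: inner_simps inner_commute power2_eq_square algebra_simps norm_eq_1)
    moreover have "inner w (A *v v) = b + l * inner w v"
      unfolding b_def power2_norm_eq_inner by (simp add: w_def inner_simps)
    ultimately show ?thesis by (simp add: c_def algebra_simps)
  qed
  have "b = 0"
  proof (rule ccontr)
    assume "b \<noteq> 0"
    then have "b > 0" by (simp add: b_def)
    \<comment> \<open>A small positive \<open>t\<close> contradicts this; \<open>c + 1\<close> in
      place of \<open>c\<close> keeps the choice meaningful when \<open>c = 0\<close>.\<close>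
    have "2 * (b / (c + 1)) * b \<le> (b / (c + 1))\<^sup>2 * c" by (rule quad)
    also have "\<dots> \<le> (b / (c + 1))\<^sup>2 * (c + 1)" by (intro mult_left_mono) auto
    also have "\<dots> = b / (c + 1) * b" using c0 by (simp add: power2_eq_square)
    finally have "b / (c + 1) * b \<le> 0" by simp
    moreover have "b / (c + 1) * b > 0" using \<open>b > 0\<close> c0 by simp
    ultimately show False by simp
  qed
  then have ev: "A *v v = l *\<^sub>R v" by (simp add: b_def w_def)
  have vv: "cinner v v = 1" using v by (simp add: cinner_same)
  have uv: "cinner (u j) v = 0" "cinner v (u j) = 0" if "j \<in> S" for j
    using v(2) that by (auto simp: T_def intro: trans[OF cinner_cnj])
  show ?case
    by (rule exI[of _ "u(k := v)"], rule exI[of _ "d(k := l)"])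
      (use 2 eig on ev vv uv in auto)
qed


section \<open>Unitary and diagonal matrices, diagonalisation\<close>

definition unitary_mat :: "complex^'n^'n \<Rightarrow> bool" where
  "unitary_mat Q \<longleftrightarrow> madj Q ** Q = mat 1"

lemma unitary_matD:
  assumes "unitary_mat Q"
  shows "madj Q ** Q = mat 1" "Q ** madj Q = mat 1"
  using assms matrix_left_right_inverse by (auto simp: unitary_mat_def)

lemma unitary_mat_madj: "unitary_mat Q \<Longrightarrow> unitary_mat (madj Q)"
  using unitary_matD by (simp add: unitary_mat_def)

lemma unitary_mat_mult:
  assumes "unitary_mat P" "unitary_mat Q"
  shows "unitary_mat (P ** Q)"
proof -
  have "madj (P ** Q) ** (P ** Q) = madj Q ** (madj P ** P) ** Q"
    by (simp add: madj_mult matrix_mul_assoc)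
  then show ?thesis
    using assms by (simp add: unitary_mat_def)
qed

lemma trace_unitary_conj:
  assumes "unitary_mat Q"
  shows "trace (Q ** A ** madj Q) = trace A"
proof -
  have "trace (Q ** A ** madj Q) = trace ((madj Q ** Q) ** A)"
    by (simp add: trace_mul_sym[of _ "madj Q"] matrix_mul_assoc)
  then show ?thesis
    using assms by (simp add: unitary_mat_def)
qed

lemma norm_unitary_mult:
  assumes "unitary_mat Q"
  shows "norm (Q *v x) = norm x"
proof -
  have "cinner (Q *v x) (Q *v x) = cinner x x"
    using assms by (simp add: cinner_adjoint matrix_vector_mul_assoc unitary_mat_def)
  then show ?thesis
    by (simp add: cinner_same power_eq_iff_eq_base del: of_real_power)
qed

definition mdiag :: "('n \<Rightarrow> complex) \<Rightarrow> complex^'n^'n" where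
  "mdiag f = (\<chi> i j. if i = j then f i else 0)"

lemma mult_mdiag_nth: "(A ** mdiag f) $ i $ j = A $ i $ j * f j"
proof -
  have "(A ** mdiag f) $ i $ j = (\<Sum>k\<in>UNIV. if k = j then A $ i $ k * f k else 0)"
    by (simp add: matrix_matrix_mult_def mdiag_def if_distrib cong: if_cong)
  then show ?thesis by simp
qed

lemma mdiag_mult: "mdiag f ** mdiag g = mdiag (\<lambda>i. f i * g i)"
  by (simp add: vec_eq_iff mult_mdiag_nth) (simp add: mdiag_def)

lemma madj_mdiag: "madj (mdiag f) = mdiag (\<lambda>i. cnj (f i))"
  by (simp add: madj_def mdiag_def vec_eq_iff)

lemma mdiag_1: "mdiag (\<lambda>i. 1) = mat 1"
  by (simp add: mdiag_def mat_def)

lemma trace_mdiag: "trace (mdiag f) = sum f UNIV"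
  by (simp add: trace_def mdiag_def)

text \<open>With the eigenvectors as columns of \<open>Q\<close>, orthonormality is unitarity and
  the eigenvalue equations, read column by column, say that \<open>A ** Q\<close> is
  \<open>Q\<close> times a diagonal matrix.\<close>

lemma spectral_theorem:
  fixes A :: "complex^'n^'n"
  assumes "hermitian A"
  obtains Q :: "complex^'n^'n" and d :: "'n \<Rightarrow> real"
    where "unitary_mat Q" "A = Q ** mdiag (\<lambda>i. of_real (d i)) ** madj Q"
proof -
  obtain u :: "'n \<Rightarrow> complex^'n" and d :: "'n \<Rightarrow> real"
    where eig: "\<And>i. A *v u i = d i *\<^sub>R u i"
      and on: "\<And>i j. cinner (u i) (u j) = (if i = j then 1 else 0)"
    using orthonormal_eigenvectors[OF assms, of UNIV] by blast
  define Q :: "complex^'n^'n" where "Q = (\<chi> i j. u j $ i)"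
  have Q: "unitary_mat Q"
    using on by (simp add: unitary_mat_def vec_eq_iff matrix_matrix_mult_def madj_def Q_def mat_def
        cinner_def)
  have "A ** Q = Q ** mdiag (\<lambda>i. of_real (d i))"
    using eig
    by (simp add: vec_eq_iff mult_mdiag_nth)
       (simp add: vec_eq_iff matrix_matrix_mult_def matrix_vector_mult_def Q_def scaleR_conv_of_real mult.commute)
  then have "A ** (Q ** madj Q) = Q ** mdiag (\<lambda>i. of_real (d i)) ** madj Q"
    by (simp add: matrix_mul_assoc)
  then show ?thesis
    using Q that by (simp add: unitary_matD)
qed

subsection \<open>Square roots and the trace norm\<close>

lemma psd_iff_cinner: "psd A \<longleftrightarrow> hermitian A \<and> (\<forall>v. 0 \<le> Re (cinner v (A *v v)))"
  by (simp add: psd_def cinner_def)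

lemma psd_mdiag_conj:
  fixes s :: "'n::finite \<Rightarrow> real"
  assumes "\<And>i. s i \<ge> 0"
  shows "psd (Q ** mdiag (\<lambda>i. of_real (s i)) ** madj Q)"
proof -
  let ?D = "mdiag (\<lambda>i. of_real (s i)) :: complex^'n^'n"
  have "0 \<le> Re (cinner v (Q ** ?D ** madj Q *v v))" for v
  proof -
    define w where "w = madj Q *v v"
    have "?D *v w = (\<chi> i. of_real (s i) * w $ i)"
      by (simp add: vec_eq_iff matrix_vector_mult_def mdiag_def if_distrib[of "\<lambda>x. x * _"] cong: if_cong)
    moreover have "cinner v (Q ** ?D ** madj Q *v v) = cinner w (?D *v w)"
      by (simp add: w_def cinner_adjoint[of v Q] flip: matrix_vector_mul_assoc)
    moreover have "Re (cnj z * (of_real r * z)) = r * (cmod z)\<^sup>2" for r z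
      unfolding cmod_power2 by (simp add: power2_eq_square algebra_simps)
    ultimately have "Re (cinner v (Q ** ?D ** madj Q *v v)) = (\<Sum>i\<in>UNIV. s i * (cmod (w $ i))\<^sup>2)"
      by (simp add: cinner_def)
    then show ?thesis
      by (simp add: sum_nonneg assms)
  qed
  then show ?thesis
    by (simp add: psd_iff_cinner hermitian_def madj_mult madj_mdiag matrix_mul_assoc)
qed

lemma column_mult: "column i (A ** B) = A *v column i B"
  by (simp add: vec_eq_iff column_def matrix_matrix_mult_def matrix_vector_mult_def)

lemma column_mult_mdiag: "column i (A ** mdiag f) = f i *s column i A"
  by (simp add: vec_eq_iff column_def mult_mdiag_nth mult.commute)

lemma madj_mult_nth: "(madj A ** B) $ i $ j = cinner (column i A) (column j B)"
  by (simp add: matrix_matrix_mult_def madj_def cinner_def column_def)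

text \<open>Since \<open>msqrt\<close> is a definite description, uniqueness has to be proved too:
  any positive semidefinite root \<open>B\<close> is shown to have the columns of \<open>Q\<close>
  as eigenvectors with eigenvalues \<open>s i\<close>, which determines it.\<close>

lemma msqrt_mdiag_conj:
  fixes s :: "'n::finite \<Rightarrow> real"
  assumes Q: "unitary_mat Q" and s: "\<And>i. s i \<ge> 0"
  shows "msqrt (Q ** mdiag (\<lambda>i. of_real ((s i)\<^sup>2)) ** madj Q) = Q ** mdiag (\<lambda>i. of_real (s i)) ** madj Q"
proof -
  let ?D = "mdiag (\<lambda>i. of_real (s i)) :: complex^'n^'n"
  let ?D2 = "mdiag (\<lambda>i. of_real ((s i)\<^sup>2)) :: complex^'n^'n"
  have "(Q ** ?D ** madj Q) ** (Q ** ?D ** madj Q) = Q ** (?D ** (madj Q ** Q) ** ?D) ** madj Q"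
    by (simp add: matrix_mul_assoc)
  also have "\<dots> = Q ** ?D2 ** madj Q"
    by (simp add: unitary_matD[OF Q] mdiag_mult power2_eq_square)
  finally have sq: "(Q ** ?D ** madj Q) ** (Q ** ?D ** madj Q) = Q ** ?D2 ** madj Q" .
  have "B = Q ** ?D ** madj Q" if B: "psd B" "B ** B = Q ** ?D2 ** madj Q" for B
  proof -
    have "B *v column i Q = of_real (s i) *s column i Q" for i
    proof -
      define u where "u = column i Q"
      \<comment> \<open>\<open>(B + s)(B - s) u = 0\<close>, and \<open>B + s\<close> is injective when \<open>s > 0\<close>.\<close>
      define w where "w = B *v u - of_real (s i) *s u"
      have "B ** B ** Q = Q ** ?D2 ** (madj Q ** Q)"
        by (simp add: B matrix_mul_assoc)
      then have "column i (B ** (B ** Q)) = column i (Q ** ?D2)"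
        by (simp add: unitary_matD[OF Q] matrix_mul_assoc)
      then have BBu: "B *v (B *v u) = of_real ((s i)\<^sup>2) *s u"
        by (simp only: column_mult[of i B] column_mult_mdiag u_def)
      then have Bw: "B *v w = (- s i) *\<^sub>R w"
        by (simp add: w_def matrix_vector_mult_diff_distrib vec.scale vec_eq_iff
            scaleR_conv_of_real[where 'a=complex] algebra_simps power2_eq_square)
      have herm: "madj B = B" using B by (simp add: psd_def hermitian_def)
      have "w = 0"
      proof (cases "s i = 0")
        case True
        then have "cinner w w = cinner u (B *v (B *v u))"
          by (simp add: w_def cinner_adjoint herm)
        then show ?thesis
          by (simp add: BBu True cinner_same)
      next
        case False
        have "0 \<le> Re (cinner w (B *v w))"
          using B by (simp add: psd_iff_cinner)
        then have "s i * (norm w)\<^sup>2 \<le> 0"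
          unfolding Bw cinner_scaleR_right cinner_same by simp
        then show ?thesis
          using False s[of i] by (simp add: mult_le_0_iff)
      qed
      then show ?thesis
        by (simp add: w_def u_def)
    qed
    then have "column i (B ** Q) = column i (Q ** ?D)" for i
      by (simp add: column_mult[of _ B] column_mult_mdiag)
    then have "B ** Q = Q ** ?D"
      by (simp add: vec_eq_iff column_def)
    then have "B ** (Q ** madj Q) = Q ** ?D ** madj Q"
      by (simp add: matrix_mul_assoc)
    then show ?thesis
      by (simp add: unitary_matD[OF Q])
  qed
  then show ?thesis
    unfolding msqrt_def using sq psd_mdiag_conj[OF s] by (intro the_equality) auto
qed

text \<open>The columns of \<open>madj A ** Q\<close> are orthogonal, so that \<open>s\<close> lists the singular values of \<open>A\<close>.\<close>

lemma trace_norm_singular_values: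
  fixes A :: "complex^'n^'n"
  obtains Q and s :: "'n \<Rightarrow> real"
  where "unitary_mat Q" "\<And>i. s i \<ge> 0" "trace_norm A = sum s UNIV"
    "madj (madj A ** Q) ** (madj A ** Q) = mdiag (\<lambda>i. of_real ((s i)\<^sup>2))"
proof -
  have "hermitian (A ** madj A)"
    by (simp add: hermitian_def madj_mult)
  then obtain Q d where Q: "unitary_mat Q"
    and AA: "A ** madj A = Q ** mdiag (\<lambda>i. of_real (d i)) ** madj Q"
    by (rule spectral_theorem)
  define W where "W = madj A ** Q"
  have "madj W ** W = madj Q ** (A ** madj A) ** Q"
    by (simp add: W_def madj_mult matrix_mul_assoc)
  also have "\<dots> = (madj Q ** Q) ** mdiag (\<lambda>i. of_real (d i)) ** (madj Q ** Q)"
    by (simp add: AA matrix_mul_assoc)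
  finally have WW: "madj W ** W = mdiag (\<lambda>i. of_real (d i))"
    by (simp add: unitary_matD[OF Q])
  \<comment> \<open>The eigenvalues are squared column norms, hence nonnegative, and
    \<open>sqrt\<close> is legitimate below.\<close>
  have "d i = (norm (column i W))\<^sup>2" for i
    using arg_cong[OF WW, of "\<lambda>M. Re (M $ i $ i)"]
    by (simp add: madj_mult_nth cinner_same mdiag_def)
  then have d: "d i \<ge> 0" for i by simp
  define s where "s i = sqrt (d i)" for i
  have d_s: "d = (\<lambda>i. (s i)\<^sup>2)" using d by (auto simp: s_def)
  have s: "s i \<ge> 0" for i by (simp add: s_def d)
  have tn: "trace_norm A = sum s UNIV"
    unfolding trace_norm_def AA d_s msqrt_mdiag_conj[OF Q s]
    by (simp add: trace_unitary_conj[OF Q] trace_mdiag)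
  show ?thesis
    by (rule that[OF Q s tn]) (use WW in \<open>simp add: W_def d_s\<close>)
qed

section \<open>Duality between the trace norm and contractions\<close>

definition contraction :: "complex^'n^'n \<Rightarrow> bool" where
  "contraction C \<longleftrightarrow> (\<forall>x. norm (C *v x) \<le> norm x)"

lemma contraction_mult: "contraction A \<Longrightarrow> contraction B \<Longrightarrow> contraction (A ** B)"
  unfolding contraction_def matrix_vector_mul_assoc[symmetric] by (meson order_trans)

lemma contraction_unitary: "unitary_mat Q \<Longrightarrow> contraction Q"
  by (simp add: contraction_def norm_unitary_mult)

lemma contraction_unitary_conj:
  "unitary_mat Q \<Longrightarrow> contraction C \<Longrightarrow> contraction (madj Q ** C ** Q)"
  by (simp add: contraction_mult contraction_unitary unitary_mat_madj)

text \<open>By cyclicity the trace becomes a sum of pairings of column \<open>i\<close> of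
  \<open>W\<close>, of norm \<open>s i\<close>, with the image under \<open>C\<close> of a unit
  vector; Cauchy-Schwarz bounds each term by \<open>s i\<close>.\<close>

lemma cmod_trace_le_trace_norm:
  fixes A :: "complex^'n^'n"
  assumes "contraction C"
  shows "cmod (trace (C ** A)) \<le> trace_norm A"
proof -
  obtain Q and s :: "'n \<Rightarrow> real" where Q: "unitary_mat Q" and s: "\<And>i. s i \<ge> 0"
    and tn: "trace_norm A = sum s UNIV"
    and WW: "madj (madj A ** Q) ** (madj A ** Q) = mdiag (\<lambda>i. of_real ((s i)\<^sup>2))"
    using trace_norm_singular_values[of A] by blast
  define W where "W = madj A ** Q"
  have W: "norm (column i W) = s i" for i
  proof -
    have "(norm (column i W))\<^sup>2 = (s i)\<^sup>2"
      using arg_cong[OF WW, of "\<lambda>M. Re (M $ i $ i)"]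
      by (simp add: madj_mult_nth cinner_same mdiag_def flip: W_def of_real_power)
    then show ?thesis using s by simp
  qed
  have Qc: "norm (column i Q) = 1" for i
  proof -
    have "(norm (column i Q))\<^sup>2 = 1"
      using arg_cong[OF unitary_matD(1)[OF Q], of "\<lambda>M. Re (M $ i $ i)"]
      by (simp add: madj_mult_nth cinner_same mat_def flip: of_real_power)
    then show ?thesis by (simp add: abs_square_eq_1)
  qed
  have "madj W ** C ** Q = madj Q ** (A ** C ** Q)"
    by (simp add: W_def madj_mult matrix_mul_assoc)
  then have "trace (madj W ** C ** Q) = trace (A ** C ** Q ** madj Q)"
    by (simp only: trace_mul_sym[of "madj Q"])
  also have "\<dots> = trace (A ** C ** (Q ** madj Q))"
    by (simp only: matrix_mul_assoc)
  finally have "trace (C ** A) = trace (madj W ** (C ** Q))"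
    by (simp add: unitary_matD[OF Q] trace_mul_sym[of C] matrix_mul_assoc)
  also have "\<dots> = (\<Sum>i\<in>UNIV. cinner (column i W) (C *v column i Q))"
    by (simp add: trace_def madj_mult_nth column_mult)
  also have "cmod \<dots> \<le> (\<Sum>i\<in>UNIV. s i)"
  proof (rule order_trans[OF norm_sum], rule sum_mono)
    fix i
    have "cmod (cinner (column i W) (C *v column i Q)) \<le> s i * norm (C *v column i Q)"
      using cinner_Cauchy_Schwarz[of "column i W"] by (simp add: W)
    also have "\<dots> \<le> s i * 1"
      using assms Qc[of i] s[of i] by (intro mult_left_mono) (auto simp: contraction_def dest: spec[of _ "column i Q"])
    finally show "cmod (cinner (column i W) (C *v column i Q)) \<le> s i" by simp
  qed
  finally show ?thesis by (simp add: tn)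
qed

text \<open>The optimal \<open>C\<close> is the adjoint of the partial isometry in the polar
  decomposition of \<open>A\<close>: it sends each column of \<open>Q\<close> to the normalised
  column of \<open>W\<close>, or to zero if that column vanishes.\<close>

lemma trace_norm_attained:
  fixes A :: "complex^'n^'n"
  obtains C where "contraction C" "trace (C ** A) = of_real (trace_norm A)"
proof -
  obtain Q and s :: "'n \<Rightarrow> real" where Q: "unitary_mat Q" and s: "\<And>i. s i \<ge> 0"
    and tn: "trace_norm A = sum s UNIV"
    and WW: "madj (madj A ** Q) ** (madj A ** Q) = mdiag (\<lambda>i. of_real ((s i)\<^sup>2))"
    using trace_norm_singular_values[of A] by blast
  define W where "W = madj A ** Q"
  define D where "D = (mdiag (\<lambda>i. of_real (1 / s i)) :: complex^'n^'n)"
  \<comment> \<open>Division by zero makes \<open>D\<close> the pseudo-inverse, so \<open>C\<close> is a partial isometry.\<close>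
  define C where "C = W ** D ** madj Q"
  note WW = WW[folded W_def]
  have D: "madj D = D" by (simp add: D_def madj_mdiag)
  have "trace (C ** A) = trace (W ** D ** (madj Q ** A))"
    by (simp add: C_def matrix_mul_assoc)
  also have "madj Q ** A = madj W"
    by (simp add: W_def madj_mult)
  also have "trace (W ** D ** madj W) = trace ((madj W ** W) ** D)"
    by (simp add: trace_mul_sym[of _ "madj W"] matrix_mul_assoc)
  also have "\<dots> = of_real (trace_norm A)"
    unfolding WW D_def mdiag_mult trace_mdiag tn of_real_sum
    by (intro sum.cong) (auto simp: power2_eq_square)
  finally have tr: "trace (C ** A) = of_real (trace_norm A)" .
  have "norm (C *v x) \<le> norm x" for x
  proof -
    define y where "y = madj Q *v x"
    \<comment> \<open>This product is the projection onto the indices with nonzero singular value,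
      so \<open>C\<close> can only shorten vectors.\<close>
    have "D ** madj W ** W ** D = D ** (madj W ** W) ** D" by (simp add: matrix_mul_assoc)
    also have "\<dots> = mdiag (\<lambda>i. if s i = 0 then 0 else 1)"
      unfolding WW D_def mdiag_mult by (auto simp: mdiag_def vec_eq_iff power2_eq_square)
    finally have P: "D ** madj W ** W ** D = mdiag (\<lambda>i. if s i = 0 then 0 else 1)" .
    have "C *v x = (W ** D) *v y"
      by (simp add: C_def y_def matrix_vector_mul_assoc)
    then have "cinner (C *v x) (C *v x) = cinner y ((D ** madj W ** W ** D) *v y)"
      by (simp add: cinner_adjoint madj_mult D matrix_vector_mul_assoc matrix_mul_assoc)
    also have "(D ** madj W ** W ** D) *v y = (\<chi> i. if s i = 0 then 0 else y $ i)"
      unfolding P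
      by (simp add: vec_eq_iff matrix_vector_mult_def mdiag_def if_distrib[of "\<lambda>x. x * _"] cong: if_cong)
    finally have "Re (cinner (C *v x) (C *v x)) =
        Re (cinner y (\<chi> i. if s i = 0 then 0 else y $ i))" by simp
    then have "(norm (C *v x))\<^sup>2 = Re (cinner y (\<chi> i. if s i = 0 then 0 else y $ i))"
      by (simp only: cinner_same Re_complex_of_real)
    also have "\<dots> \<le> Re (cinner y y)"
      unfolding cinner_def Re_sum by (intro sum_mono) auto
    also have "\<dots> = (norm y)\<^sup>2" by (simp add: cinner_same)
    finally have "norm (C *v x) \<le> norm y" by (simp add: power_mono_iff)
    then show ?thesis
      by (simp add: y_def norm_unitary_mult[OF unitary_mat_madj[OF Q]])
  qed
  then have "contraction C"
    by (simp add: contraction_def)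
  then show ?thesis
    using tr by (rule that)
qed


subsection \<open>Unitary evolution\<close>

lemma mscale_mult_left: "(c *\<^sub>M A) ** B = c *\<^sub>M (A ** B)"
  by (simp add: vec_eq_iff mscale_def matrix_matrix_mult_def sum_distrib_left mult_ac)

lemma mscale_mult_right: "A ** (c *\<^sub>M B) = c *\<^sub>M (A ** B)"
  by (simp add: vec_eq_iff mscale_def matrix_matrix_mult_def sum_distrib_left mult_ac)

lemma mscale_mscale: "a *\<^sub>M b *\<^sub>M A = (a * b) *\<^sub>M A"
  by (simp add: vec_eq_iff mscale_def mult_ac)

lemma mscale_1 [simp]: "1 *\<^sub>M A = A"
  by (simp add: vec_eq_iff mscale_def)

lemma mscale_add_right: "c *\<^sub>M (A + B) = c *\<^sub>M A + c *\<^sub>M B"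
  by (simp add: vec_eq_iff mscale_def algebra_simps)

lemma trace_mscale: "trace (c *\<^sub>M A) = c * trace A"
  by (simp add: trace_def mscale_def sum_distrib_left)

lemma mscale_mdiag: "c *\<^sub>M mdiag f = mdiag (\<lambda>i. c * f i)"
  by (simp add: vec_eq_iff mscale_def mdiag_def)

lemma mpow_unitary_conj:
  assumes "unitary_mat Q"
  shows "mpow (Q ** A ** madj Q) k = Q ** mpow A k ** madj Q"
proof (induction k)
  case 0
  then show ?case by (simp add: unitary_matD[OF assms])
next
  case (Suc k)
  have "mpow (Q ** A ** madj Q) (Suc k) = Q ** A ** (madj Q ** Q) ** mpow A k ** madj Q"
    by (simp add: Suc matrix_mul_assoc)
  then show ?case
    by (simp add: unitary_matD[OF assms] matrix_mul_assoc)
qed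

lemma mpow_mdiag: "mpow (mdiag f) k = mdiag (\<lambda>i. f i ^ k)"
  by (induction k) (simp_all add: mdiag_mult mdiag_1)

text \<open>Powers commute with unitary conjugation, so each matrix entry of the series is a finite
  combination of scalar exponential series. This also gives the convergence that \<open>mexp\<close>
  relies on.\<close>

lemma mexp_unitary_conj_mdiag:
  fixes Q :: "complex^'n^'n"
  assumes "unitary_mat Q"
  shows "mexp (Q ** mdiag f ** madj Q) = Q ** mdiag (\<lambda>i. exp (f i)) ** madj Q"
proof -
  have entry: "(Q ** mdiag g ** madj Q) $ i $ j = (\<Sum>l\<in>UNIV. Q $ i $ l * g l * cnj (Q $ j $ l))"
    for g i j
    by (subst matrix_matrix_mult_def) (simp add: mult_mdiag_nth madj_def)
  have "(\<lambda>k. \<Sum>l\<in>UNIV. Q $ i $ l * (f l ^ k /\<^sub>R fact k) * cnj (Q $ j $ l)) sums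
      (\<Sum>l\<in>UNIV. Q $ i $ l * exp (f l) * cnj (Q $ j $ l))" for i j
    by (intro sums_sum sums_mult sums_mult2 exp_converges)
  moreover have "((1 / fact k) *\<^sub>R mpow (Q ** mdiag f ** madj Q) k) $ i $ j =
      (\<Sum>l\<in>UNIV. Q $ i $ l * (f l ^ k /\<^sub>R fact k) * cnj (Q $ j $ l))" for k i j
    by (simp add: mpow_unitary_conj[OF assms] mpow_mdiag entry scaleR_right.sum
        scaleR_conv_of_real[where 'a=complex] sum_distrib_left field_simps)
  ultimately have "(\<lambda>k. (1 / fact k) *\<^sub>R mpow (Q ** mdiag f ** madj Q) k) sums
      (Q ** mdiag (\<lambda>i. exp (f i)) ** madj Q)"
    unfolding sums_def
    by (intro vec_tendstoI) (simp add: entry)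
  then show ?thesis
    unfolding mexp_def by (rule sums_unique[symmetric])
qed

text \<open>One diagonalisation of \<open>H\<close> reduces all three claims to phases: they have
  modulus one, their powers multiply the time, and the trace is a sum of \<open>CARD('n)\<close> of
  them.\<close>

lemma hermitian_evolution:
  fixes H :: "complex^'n^'n"
  assumes "hermitian H" and U_def: "U = (\<lambda>\<tau>. mexp ((- \<i> * of_real \<tau>) *\<^sub>M H))"
  shows "unitary_mat (U \<tau>)" "mpow (U \<tau>) k = U (real k * \<tau>)"
    "cmod (trace (U \<tau>)) \<le> real CARD('n)"
proof -
  obtain Q d where Q: "unitary_mat Q" and H: "H = Q ** mdiag (\<lambda>i. of_real (d i)) ** madj Q"
    using spectral_theorem[OF assms(1)] .
  define E where "E \<tau> = (mdiag (\<lambda>i. exp (- \<i> * of_real \<tau> * of_real (d i))) :: complex^'n^'n)" for \<tau>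
  have U: "U \<tau> = Q ** E \<tau> ** madj Q" for \<tau>
  proof -
    have "(- \<i> * of_real \<tau>) *\<^sub>M H = Q ** mdiag (\<lambda>i. - \<i> * of_real \<tau> * of_real (d i)) ** madj Q"
      unfolding H mscale_mult_left[of _ _ "madj Q", symmetric] mscale_mult_right[of Q, symmetric]
        mscale_mdiag ..
    then show ?thesis
      unfolding U_def E_def by (simp only: mexp_unitary_conj_mdiag[OF Q])
  qed
  have "madj (E \<tau>) ** E \<tau> = mat 1" for \<tau>
    by (simp add: E_def madj_mdiag mdiag_mult exp_cnj mdiag_1 flip: exp_add)
  then show "unitary_mat (U \<tau>)"
    unfolding U using Q by (intro unitary_mat_mult unitary_mat_madj) (simp_all add: unitary_mat_def)
  show "mpow (U \<tau>) k = U (real k * \<tau>)"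
    by (simp add: U mpow_unitary_conj[OF Q] E_def mpow_mdiag mult_ac flip: exp_of_nat_mult)
  have "trace (U \<tau>) = (\<Sum>i\<in>UNIV. exp (- \<i> * of_real \<tau> * of_real (d i)))"
    by (simp add: U trace_unitary_conj[OF Q] E_def trace_mdiag)
  moreover have "cmod (\<dots>) \<le> (\<Sum>i\<in>(UNIV::'n set). 1)"
    by (rule order_trans[OF norm_sum], rule sum_mono) (simp add: norm_exp_eq_Re)
  ultimately show "cmod (trace (U \<tau>)) \<le> real CARD('n)"
    by simp
qed

subsection \<open>Pseudo-controllization\<close>

lemma sum_UNIV_prod:
  "(\<Sum>p\<in>UNIV. f p) = (\<Sum>i\<in>UNIV. \<Sum>j\<in>UNIV. f (i, j))" for f :: "'a::finite \<times> 'b::finite \<Rightarrow> 'c::comm_monoid_add"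
  by (simp add: sum.cartesian_product)

lemma mtensor_mult: "(A \<otimes>\<^sub>M B) ** (C \<otimes>\<^sub>M D) = (A ** C) \<otimes>\<^sub>M (B ** D)"
  by (simp add: vec_eq_iff mtensor_def matrix_matrix_mult_def sum_UNIV_prod sum_product mult_ac)

lemma madj_mtensor: "madj (A \<otimes>\<^sub>M B) = madj A \<otimes>\<^sub>M madj B"
  by (simp add: vec_eq_iff mtensor_def madj_def)

lemma mtensor_mat_1: "mat 1 \<otimes>\<^sub>M mat 1 = mat 1"
  by (auto simp: vec_eq_iff mtensor_def mat_def prod_eq_iff)

lemma mtensor_add_left: "(A + B) \<otimes>\<^sub>M C = A \<otimes>\<^sub>M C + B \<otimes>\<^sub>M C"
  by (simp add: vec_eq_iff mtensor_def algebra_simps)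

lemma mtensor_mscale_right: "A \<otimes>\<^sub>M (c *\<^sub>M B) = c *\<^sub>M (A \<otimes>\<^sub>M B)"
  by (simp add: vec_eq_iff mtensor_def mscale_def)

lemma ptrace_mtensor: "ptrace (A \<otimes>\<^sub>M B) = trace B *\<^sub>M A"
  by (simp add: vec_eq_iff ptrace_def mtensor_def trace_def mscale_def sum_distrib_left mult.commute)

lemma ptrace_add: "ptrace (A + B) = ptrace A + ptrace B"
  by (simp add: vec_eq_iff ptrace_def sum.distrib)

lemma matrix_add_rdistrib: "(A + B) ** C = A ** C + B ** (C :: complex^'n^'m)"
  by (simp add: vec_eq_iff matrix_matrix_mult_def sum.distrib algebra_simps)

lemma matrix_diff_ldistrib: "A ** (B - C) = A ** B - A ** (C :: complex^'n^'m)"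
  by (simp add: vec_eq_iff matrix_matrix_mult_def sum_subtractf algebra_simps)

lemma proj_mult_proj: "proj k ** proj l = (if k = l then proj k else 0)"
  by (auto simp: vec_eq_iff proj_def matrix_matrix_mult_def if_distrib[of "\<lambda>x. x * _"] cong: if_cong)

lemma madj_proj: "madj (proj k) = proj k"
  by (simp add: vec_eq_iff proj_def madj_def)

lemma proj_01: "proj 0 + proj (1::2) = mat 1"
  by (simp add: vec_eq_iff forall_2 proj_def mat_def)

lemma exhaust_2_0: "(c::2) = 0 \<or> c = 1"
  using exhaust_2[of c] by auto

text \<open>Conjugation by the controlled swap moves \<open>U\<close> to the ancilla when the
  control is 0 and leaves it on the target when the control is 1.\<close>

lemma W_gate_eq:
  fixes U :: "complex^'d^'d"
  shows "W_gate U = proj 0 \<otimes>\<^sub>M mat 1 \<otimes>\<^sub>M U + proj 1 \<otimes>\<^sub>M U \<otimes>\<^sub>M mat 1"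
proof -
  \<comment> \<open>\<open>cswap\<close> is the permutation matrix of the involution
    \<open>sw\<close>, so multiplying by it on either side only reindexes entries.\<close>
  define sw :: "(2 \<times> 'd) \<times> 'd \<Rightarrow> (2 \<times> 'd) \<times> 'd"
    where "sw p = (case p of ((c, i), j) \<Rightarrow> if c = 0 then ((c, j), i) else p)" for p
  have cswap: "(cswap :: complex^((2 \<times> 'd) \<times> 'd)^((2 \<times> 'd) \<times> 'd)) $ p $ q = (if q = sw p then 1 else 0)"
    "(q = sw p) = (p = sw q)" for p q
    by (cases p; cases q; auto simp: cswap_def sw_def split: prod.splits if_splits)+
  have left: "(cswap ** M) $ p $ q = M $ sw p $ q" for M :: "complex^((2 \<times> 'd) \<times> 'd)^((2 \<times> 'd) \<times> 'd)" and p q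
    by (simp add: matrix_matrix_mult_def cswap(1) if_distrib[of "\<lambda>x. x * _"] cong: if_cong)
  have right: "(M ** cswap) $ p $ q = M $ p $ sw q" for M :: "complex^((2 \<times> 'd) \<times> 'd)^((2 \<times> 'd) \<times> 'd)" and p q
    unfolding matrix_matrix_mult_def cswap(1)
    by (simp add: cswap(2)[of q] if_distrib[of "\<lambda>x. _ * x"] cong: if_cong)
  have "W_gate U $ ((c, i), j) $ ((c', i'), j') =
     (proj 0 \<otimes>\<^sub>M mat 1 \<otimes>\<^sub>M U + proj 1 \<otimes>\<^sub>M U \<otimes>\<^sub>M mat 1) $ ((c, i), j) $ ((c', i'), j')" for c i j c' i' j'
    using exhaust_2_0[of c] exhaust_2_0[of c']
    by (auto simp: W_gate_def left right sw_def mtensor_def mat_def proj_def)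
  then show ?thesis
    unfolding vec_eq_iff split_paired_All by blast
qed


section \<open>Controlled gates and the pseudo-controllization map as a mixture\<close>

lemma ctrl_mult: "ctrl V ** ctrl W = ctrl (V ** W)"
  by (simp add: ctrl_def matrix_add_rdistrib matrix_add_ldistrib mtensor_mult proj_mult_proj)
     (simp add: vec_eq_iff mtensor_def)

lemma madj_ctrl: "madj (ctrl V) = ctrl (madj V)"
  by (simp add: ctrl_def madj_add madj_mtensor madj_proj)

lemma ctrl_mat_1: "ctrl (mat 1) = mat 1"
  by (simp add: ctrl_def proj_01 mtensor_mat_1 flip: mtensor_add_left)

lemma unitary_mat_ctrl: "unitary_mat V \<Longrightarrow> unitary_mat (ctrl V)"
  by (simp add: unitary_mat_def madj_ctrl ctrl_mult ctrl_mat_1)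

lemma unitary_mat_mtensor: "unitary_mat A \<Longrightarrow> unitary_mat B \<Longrightarrow> unitary_mat (A \<otimes>\<^sub>M B)"
  by (simp add: unitary_mat_def madj_mtensor mtensor_mult mtensor_mat_1)

lemma unitary_mat_mscale: "cmod c = 1 \<Longrightarrow> unitary_mat A \<Longrightarrow> unitary_mat (c *\<^sub>M A)"
  by (simp add: unitary_mat_def madj_mscale mscale_mult_left mscale_mult_right mscale_mscale
      complex_norm_square[symmetric] mult.commute[of "cnj c"])

lemma ctrl_conj_ctrl_conj: "ctrl_conj V (ctrl_conj W \<rho>) = ctrl_conj (V ** W) \<rho>"
  by (simp add: ctrl_conj_def madj_mult matrix_mul_assoc flip: ctrl_mult)

lemma ctrl_conj_add: "ctrl_conj V (\<rho> + \<sigma>) = ctrl_conj V \<rho> + ctrl_conj V \<sigma>"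
  by (simp add: ctrl_conj_def matrix_add_rdistrib matrix_add_ldistrib)

lemma ctrl_conj_mscale: "ctrl_conj V (c *\<^sub>M \<rho>) = c *\<^sub>M ctrl_conj V \<rho>"
  by (simp add: ctrl_conj_def mscale_mult_left mscale_mult_right)

text \<open>Tracing out the ancilla keeps the blocks diagonal in the control and weights the
  off-diagonal ones by \<open>trace U / d\<close> or its conjugate. The two conjugations agree on
  diagonal blocks and have opposite signs off the diagonal, so weights with difference
  \<open>a\<close> reproduce that factor.\<close>

lemma pseudo_ctrl_eq:
  fixes U :: "complex^'d^'d" and \<rho> :: "complex^(2 \<times> 'd)^(2 \<times> 'd)"
  assumes U: "unitary_mat U" and e: "cmod e = 1" and tr: "trace U / of_nat CARD('d) = of_real a * cnj e"
  shows "pseudo_ctrl U \<rho> = ((1 + of_real a) / 2) *\<^sub>M ctrl_conj (e *\<^sub>M U) \<rho> +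
    ((1 - of_real a) / 2) *\<^sub>M ctrl_conj ((- e) *\<^sub>M U) \<rho>"
proof -
  define K0 :: "complex^(2 \<times> 'd)^(2 \<times> 'd)" where "K0 = proj 0 \<otimes>\<^sub>M mat 1"
  define K1 :: "complex^(2 \<times> 'd)^(2 \<times> 'd)" where "K1 = proj 1 \<otimes>\<^sub>M U"
  define d :: complex where "d = of_nat CARD('d)"
  have d: "d \<noteq> 0" "cnj d = d" by (simp_all add: d_def)
  have sigma: "mat (1 / of_nat CARD('d)) = (1 / d) *\<^sub>M (mat 1 :: complex^'d^'d)"
    by (simp add: vec_eq_iff mat_def mscale_def d_def)
  have tr1: "trace (mat 1 :: complex^'d^'d) = d"
    by (simp add: trace_def mat_def d_def)
  have tr_adj: "trace (madj U) = cnj (trace U)"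
    by (simp add: trace_def madj_def)
  have trU: "trace U = d * (of_real a * cnj e)"
    using tr d by (simp add: d_def field_simps)
  then have "cnj (trace U) = d * (of_real a * e)"
    by (simp add: d_def)
  note trU = trU this
  have ee: "e * cnj e = 1" using e by (simp add: complex_norm_square[symmetric])
  have ctrl: "ctrl (c *\<^sub>M U) = K0 + c *\<^sub>M K1" for c
    by (simp add: ctrl_def K0_def K1_def mtensor_mscale_right)
  have "pseudo_ctrl U \<rho> = K0 ** \<rho> ** madj K0 + K1 ** \<rho> ** madj K1 +
      (of_real a * cnj e) *\<^sub>M (K0 ** \<rho> ** madj K1) + (of_real a * e) *\<^sub>M (K1 ** \<rho> ** madj K0)"
    using d
    by (simp add: pseudo_ctrl_def W_gate_eq K0_def[symmetric] K1_def[symmetric] sigma madj_add madj_mtensor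
        matrix_add_rdistrib matrix_add_ldistrib mtensor_mult ptrace_add ptrace_mtensor
        mscale_mult_left mscale_mult_right trace_mscale unitary_matD[OF U] tr1 tr_adj trU add_ac)
  \<comment> \<open>Applied with \<open>c = e\<close> and \<open>c = - e\<close>: then
    \<open>c * cnj c = 1\<close>, and only the off-diagonal terms change sign.\<close>
  moreover have "ctrl_conj (c *\<^sub>M U) \<rho> = K0 ** \<rho> ** madj K0 + (c * cnj c) *\<^sub>M (K1 ** \<rho> ** madj K1) +
      cnj c *\<^sub>M (K0 ** \<rho> ** madj K1) + c *\<^sub>M (K1 ** \<rho> ** madj K0)" for c
    by (simp add: ctrl_conj_def ctrl madj_add madj_mscale matrix_add_rdistrib matrix_add_ldistrib
        mscale_mult_left mscale_mult_right mscale_mscale mscale_add_right add_ac mult_ac)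
  ultimately show ?thesis
    by (simp add: ee) (simp add: vec_eq_iff mscale_def field_simps)
qed

text \<open>Signs multiply under composition, so the mixture behaves like a product of independent
  random signs: mean \<open>a\<close> composed with mean \<open>b\<close> gives mean
  \<open>a * b\<close>.\<close>

lemma pseudo_ctrl_funpow:
  fixes U :: "complex^'d^'d"
  assumes "unitary_mat U" "cmod e = 1" "trace U / of_nat CARD('d) = of_real a * cnj e"
  shows "(pseudo_ctrl U ^^ m) \<rho> =
    ((1 + of_real (a ^ m)) / 2) *\<^sub>M ctrl_conj (e ^ m *\<^sub>M mpow U m) \<rho> +
    ((1 - of_real (a ^ m)) / 2) *\<^sub>M ctrl_conj ((- (e ^ m)) *\<^sub>M mpow U m) \<rho>"
proof (induction m)
  case 0
  have "ctrl_conj (mat 1) \<rho> = \<rho>"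
    by (simp add: ctrl_conj_def ctrl_mat_1)
  then show ?case by (simp add: vec_eq_iff mscale_def)
next
  case (Suc m)
  define b where "b = complex_of_real (a ^ m)"
  define P where "P = ctrl_conj (e ^ Suc m *\<^sub>M mpow U (Suc m)) \<rho>"
  define N where "N = ctrl_conj ((- (e ^ Suc m)) *\<^sub>M mpow U (Suc m)) \<rho>"
  have "(pseudo_ctrl U ^^ Suc m) \<rho> = pseudo_ctrl U ((pseudo_ctrl U ^^ m) \<rho>)"
    by simp
  \<comment> \<open>Of the four compositions, equal signs give \<open>P\<close> and opposite signs
    give \<open>N\<close>.\<close>
  also have "\<dots> =
      ((1 + of_real a) / 2) *\<^sub>M (((1 + b) / 2) *\<^sub>M P + ((1 - b) / 2) *\<^sub>M N) +
      ((1 - of_real a) / 2) *\<^sub>M (((1 + b) / 2) *\<^sub>M N + ((1 - b) / 2) *\<^sub>M P)"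
    unfolding Suc pseudo_ctrl_eq[OF assms] ctrl_conj_add ctrl_conj_mscale ctrl_conj_ctrl_conj
      mscale_mult_left mscale_mult_right mscale_mscale
    by (simp add: P_def N_def b_def mult.commute)
  also have "\<dots> = ((1 + of_real a * b) / 2) *\<^sub>M P + ((1 - of_real a * b) / 2) *\<^sub>M N"
    by (simp add: vec_eq_iff mscale_def field_simps)
  finally show ?case
    by (simp add: P_def N_def b_def)
qed

subsection \<open>Diamond norm\<close>

lemma superop_tensor_id_mult:
  "superop_tensor_id (\<lambda>\<rho>. L ** \<rho> ** M) A = (L \<otimes>\<^sub>M mat 1) ** A ** (M \<otimes>\<^sub>M mat 1)"
  by (simp add: vec_eq_iff superop_tensor_id_def mtensor_def matrix_matrix_mult_def sum_UNIV_prod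
      mat_def if_distrib[of "\<lambda>x. _ * x"] if_distrib[of "\<lambda>x. x * _"] cong: if_cong)

section \<open>Matrix units and their trace norm\<close>

definition munit :: "'n \<Rightarrow> 'n \<Rightarrow> complex^'n^'n" where
  "munit p q = (\<chi> i j. if i = p \<and> j = q then 1 else 0)"

lemma trace_mult_munit: "trace (C ** munit p q) = C $ q $ p"
proof -
  have "(C ** munit p q) $ i $ j = (if j = q then C $ i $ p else 0)" for i j
    by (cases "j = q") (simp_all add: matrix_matrix_mult_def munit_def if_distrib[of "\<lambda>x. _ * x"] cong: if_cong)
  then show ?thesis by (simp add: trace_def)
qed

lemma norm_axis: "norm (axis i (z :: complex)) = cmod z"
  by (simp add: norm_vec_def L2_set_def axis_def if_distrib[of norm] if_distrib[of "\<lambda>x. x\<^sup>2"] cong: if_cong)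

lemma contraction_munit: "contraction (munit p q)"
  unfolding contraction_def
proof
  fix x :: "complex^'a"
  have "munit p q *v x = axis p (x $ q)"
    by (auto simp: vec_eq_iff munit_def matrix_vector_mult_def axis_def if_distrib[of "\<lambda>x. x * _"] cong: if_cong)
  then show "norm (munit p q *v x) \<le> norm x"
    by (simp add: Finite_Cartesian_Product.norm_nth_le norm_axis)
qed

lemma cmod_contraction_nth_le:
  assumes "contraction C"
  shows "cmod (C $ p $ q) \<le> 1"
proof -
  have "(C *v axis q 1) $ p = C $ p $ q"
    by (simp add: matrix_vector_mult_def axis_def if_distrib[of "\<lambda>x. _ * x"] cong: if_cong)
  then have "cmod (C $ p $ q) \<le> norm (C *v axis q 1)"
    by (metis Finite_Cartesian_Product.norm_nth_le)
  also have "\<dots> \<le> norm (axis q 1 :: complex^'a)"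
    using assms unfolding contraction_def by blast
  finally show ?thesis by (simp add: norm_axis)
qed

text \<open>Both bounds come from duality: the trace against \<open>C\<close> reads off one entry of
  \<open>C\<close>, which has modulus at most one for a contraction and equals one for the
  transposed unit.\<close>

lemma trace_norm_munit: "trace_norm (munit p q) = 1"
proof (rule antisym)
  obtain C where C: "contraction C" "trace (C ** munit p q) = of_real (trace_norm (munit p q))"
    by (rule trace_norm_attained)
  then show "trace_norm (munit p q) \<le> 1"
    using cmod_contraction_nth_le[OF C(1), of q p] by (simp add: trace_mult_munit)
  have "trace (munit q p ** munit p q) = 1"
    by (simp only: trace_mult_munit) (simp add: munit_def)
  then show "1 \<le> trace_norm (munit p q)"
    using cmod_trace_le_trace_norm[OF contraction_munit, of q p "munit p q"] by simp
qed

text \<open>The difference between the iterated map and the ideal gate has this form with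
  \<open>c = (1 - a ^ m) / 2\<close>. The triangle inequality bounds the norm by
  \<open>2 * c\<close>, and a matrix unit attains it.\<close>

lemma diamond_norm_ctrl_conj_diff:
  fixes V :: "complex^'d^'d" and c :: real
  assumes V: "unitary_mat V" and c: "c \<ge> 0"
  shows "diamond_norm (\<lambda>\<rho>. of_real c *\<^sub>M (ctrl_conj ((- 1) *\<^sub>M V) \<rho> - ctrl_conj V \<rho>)) = 2 * c"
proof -
  define S :: "complex^(2 \<times> 'd)^(2 \<times> 'd) \<Rightarrow> complex^(2 \<times> 'd)^(2 \<times> 'd)"
    where "S = (\<lambda>\<rho>. of_real c *\<^sub>M (ctrl_conj ((- 1) *\<^sub>M V) \<rho> - ctrl_conj V \<rho>))"
  define L :: "complex^((2 \<times> 'd) \<times> (2 \<times> 'd))^((2 \<times> 'd) \<times> (2 \<times> 'd))" where "L = ctrl V \<otimes>\<^sub>M mat 1"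
  define N :: "complex^((2 \<times> 'd) \<times> (2 \<times> 'd))^((2 \<times> 'd) \<times> (2 \<times> 'd))"
    where "N = ctrl ((- 1) *\<^sub>M V) \<otimes>\<^sub>M mat 1"
  have I: "unitary_mat (mat 1)" by (simp add: unitary_mat_def)
  have LN: "unitary_mat L" "unitary_mat N"
    unfolding L_def N_def by (intro unitary_mat_mtensor unitary_mat_ctrl unitary_mat_mscale V I; simp)+
  have S_eq: "superop_tensor_id S A = of_real c *\<^sub>M (N ** A ** madj N - L ** A ** madj L)"
    for A :: "complex^((2 \<times> 'd) \<times> (2 \<times> 'd))^((2 \<times> 'd) \<times> (2 \<times> 'd))"
  proof -
    have "superop_tensor_id S A = of_real c *\<^sub>M (superop_tensor_id (ctrl_conj ((- 1) *\<^sub>M V)) A - superop_tensor_id (ctrl_conj V) A)"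
      by (simp add: S_def vec_eq_iff superop_tensor_id_def mscale_def)
    then show ?thesis
      by (simp add: ctrl_conj_def[abs_def] superop_tensor_id_mult L_def N_def madj_mtensor)
  qed
  have upper: "trace_norm (superop_tensor_id S A) \<le> 2 * c" if A: "trace_norm A = 1"
    for A :: "complex^((2 \<times> 'd) \<times> (2 \<times> 'd))^((2 \<times> 'd) \<times> (2 \<times> 'd))"
  proof -
    obtain C where C: "contraction C"
      "trace (C ** superop_tensor_id S A) = of_real (trace_norm (superop_tensor_id S A))"
      by (rule trace_norm_attained)
    \<comment> \<open>Cyclicity moves the unitary conjugation from \<open>A\<close> to
      \<open>C\<close>, which remains a contraction.\<close>
    have tr: "trace (C ** (M ** A ** madj M)) = trace (madj M ** C ** M ** A)" for M
      by (simp add: trace_mul_sym[of _ "madj M"] matrix_mul_assoc)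
    have "C ** superop_tensor_id S A = of_real c *\<^sub>M (C ** (N ** A ** madj N) - C ** (L ** A ** madj L))"
      by (simp only: S_eq mscale_mult_right matrix_diff_ldistrib)
    then have "of_real (trace_norm (superop_tensor_id S A)) =
        of_real c * (trace (madj N ** C ** N ** A) - trace (madj L ** C ** L ** A))"
      by (simp only: C(2)[symmetric] trace_mscale trace_sub tr)
    then have "trace_norm (superop_tensor_id S A) \<le>
        cmod (of_real c * (trace (madj N ** C ** N ** A) - trace (madj L ** C ** L ** A)))"
      by (metis norm_of_real abs_ge_self)
    also have "\<dots> \<le> c * (cmod (trace (madj N ** C ** N ** A)) + cmod (trace (madj L ** C ** L ** A)))"
      unfolding norm_mult using c by (simp add: mult_left_mono norm_triangle_ineq4)
    also have "\<dots> \<le> c * (1 + 1)"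
      unfolding A[symmetric] using c
      by (intro mult_left_mono add_mono cmod_trace_le_trace_norm contraction_unitary_conj LN C)
    finally show ?thesis by simp
  qed
  \<comment> \<open>The two indices differ only in the control qubit; \<open>undefined\<close>
    stands for an arbitrary fixed index of the target and of the reference system.\<close>
  define p q :: "(2 \<times> 'd) \<times> (2 \<times> 'd)" where "p = ((0, undefined), undefined)" and "q = ((1, undefined), undefined)"
  have "N ** munit p q ** madj N = (- 1) *\<^sub>M (L ** munit p q ** madj L)"
  proof -
    \<comment> \<open>\<open>N\<close> is \<open>L\<close> preceded by the sign flip
      \<open>Z\<close> on control value 1. Exactly one of \<open>p\<close> and \<open>q\<close> is
      flipped, so the matrix unit changes sign.\<close>
    define z :: "(2 \<times> 'd) \<times> (2 \<times> 'd) \<Rightarrow> complex" where "z r = (if fst (fst r) = 0 then 1 else - 1)" for r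
    define Z :: "complex^((2 \<times> 'd) \<times> (2 \<times> 'd))^((2 \<times> 'd) \<times> (2 \<times> 'd))"
      where "Z = ctrl ((- 1) *\<^sub>M mat 1) \<otimes>\<^sub>M mat 1"
    have Z: "Z = mdiag z"
      using exhaust_2_0
      by (auto simp: Z_def z_def vec_eq_iff ctrl_def mtensor_def proj_def mat_def mdiag_def mscale_def)
    have N: "N = L ** Z"
      by (simp add: N_def L_def Z_def mtensor_mult ctrl_mult mscale_mult_right)
    have "mdiag z ** munit p q ** mdiag z = (- 1) *\<^sub>M munit p q"
      by (auto simp: vec_eq_iff mult_mdiag_nth munit_def mscale_def z_def p_def q_def matrix_matrix_mult_def mdiag_def
           if_distrib[of "\<lambda>x. x * _"] cong: if_cong)
    moreover have "madj (mdiag z) = mdiag z"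
      unfolding madj_mdiag by (rule arg_cong[of _ _ mdiag]) (simp add: z_def fun_eq_iff)
    moreover have "N ** munit p q ** madj N = L ** (mdiag z ** munit p q ** madj (mdiag z)) ** madj L"
      by (simp add: N Z madj_mult matrix_mul_assoc)
    ultimately show ?thesis
      by (simp add: mscale_mult_left mscale_mult_right)
  qed
  then have "superop_tensor_id S (munit p q) = (- 2 * of_real c) *\<^sub>M (L ** munit p q ** madj L)"
    unfolding S_eq by (simp add: vec_eq_iff mscale_def)
  \<comment> \<open>The transposed unit, conjugated by \<open>L\<close>, is the contraction that
    witnesses the lower bound: paired with the conjugated \<open>munit p q\<close> it has trace
    one.\<close>
  moreover have "(L ** munit q p ** madj L) ** (L ** munit p q ** madj L) =
      L ** (munit q p ** (madj L ** L) ** munit p q) ** madj L"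
    by (simp only: matrix_mul_assoc)
  moreover have "trace (munit q p ** munit p q) = 1"
    by (simp only: trace_mult_munit) (simp add: munit_def)
  ultimately have "trace ((L ** munit q p ** madj L) ** superop_tensor_id S (munit p q)) = - 2 * of_real c"
    by (simp only: mscale_mult_right trace_mscale unitary_matD[OF LN(1)] matrix_mul_rid
        trace_unitary_conj[OF LN(1)]) simp
  moreover have "contraction (L ** munit q p ** madj L)"
    by (intro contraction_mult contraction_munit contraction_unitary unitary_mat_madj LN)
  ultimately have "cmod (- 2 * of_real c) \<le> trace_norm (superop_tensor_id S (munit p q))"
    by (metis cmod_trace_le_trace_norm)
  then have eq: "trace_norm (superop_tensor_id S (munit p q)) = 2 * c"
    using upper[of "munit p q"] c by (simp add: trace_norm_munit norm_mult)
  show ?thesis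
    unfolding diamond_norm_def S_def[symmetric]
    by (rule Greatest_equality) (use upper eq trace_norm_munit in \<open>blast intro: eq[symmetric]\<close>)+
qed

section \<open>Distance of the iterated map from the ideal controlled evolution\<close>

theorem theorem1:
  fixes H :: "complex^'d^'d" and U :: "real \<Rightarrow> complex^'d^'d"
    and t a \<phi> :: real and \<gamma> :: complex and m :: nat
  assumes "hermitian H"
    and "m \<ge> 1"
    and "U = (\<lambda>\<tau>. mexp ((- \<i> * of_real \<tau>) *\<^sub>M H))"
    and "trace (U (t / real m)) \<noteq> 0"
    and "\<gamma> = trace (U (t / real m)) / of_nat CARD('d)"
    and "a = cmod \<gamma>"
    and "exp (\<i> * of_real \<phi>) = cnj \<gamma> / of_real a"
  shows "diamond_norm (\<lambda>\<rho>. (pseudo_ctrl (U (t / real m)) ^^ m) \<rho>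
           - ctrl_conj (exp (\<i> * of_nat m * of_real \<phi>) *\<^sub>M U t) \<rho>) = 1 - a ^ m"
proof -
  define e where "e = exp (\<i> * of_real \<phi>)"
  define u where "u = U (t / real m)"
  define V where "V = e ^ m *\<^sub>M U t"
  note U = hermitian_evolution[OF assms(1,3)]
  have e: "cmod e = 1" by (simp add: e_def)
  have em: "exp (\<i> * of_nat m * of_real \<phi>) = e ^ m"
    by (simp add: e_def mult_ac flip: exp_of_nat_mult)
  have a0: "a \<noteq> 0" using assms(4-6) by simp
  \<comment> \<open>Conjugating the phase condition gives \<open>cnj e = \<gamma> / a\<close>; here
    \<open>a\<close> must be nonzero.\<close>
  have tr: "trace u / of_nat CARD('d) = of_real a * cnj e"
    using a0 assms(7) by (simp add: u_def e_def flip: assms(5))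
  have um: "mpow u m = U t"
    using assms(2) by (simp add: u_def U(2))
  have "a \<le> 1"
    using U(3)[of "t / real m"] by (simp add: assms(5,6) norm_divide)
  then have c: "(1 - a ^ m) / 2 \<ge> 0"
    using assms(6) by (simp add: power_le_one)
  have V: "unitary_mat V"
    unfolding V_def by (intro unitary_mat_mscale U(1)) (simp add: norm_power e)
  \<comment> \<open>Subtracting the ideal gate turns the weight \<open>(1 + a ^ m) / 2\<close> into
    \<open>- (1 - a ^ m) / 2\<close>, the negative of the other weight.\<close>
  have "(pseudo_ctrl u ^^ m) \<rho> - ctrl_conj V \<rho> =
      of_real ((1 - a ^ m) / 2) *\<^sub>M (ctrl_conj ((- 1) *\<^sub>M V) \<rho> - ctrl_conj V \<rho>)" for \<rho>
  proof -
    have uu: "unitary_mat u" by (simp add: u_def U(1))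
    have "(- (e ^ m)) *\<^sub>M U t = (- 1) *\<^sub>M V" by (simp add: V_def mscale_mscale)
    then show ?thesis
      unfolding pseudo_ctrl_funpow[OF uu e tr] um V_def[symmetric]
      by (simp add: vec_eq_iff mscale_def field_simps)
  qed
  then have "diamond_norm (\<lambda>\<rho>. (pseudo_ctrl u ^^ m) \<rho> - ctrl_conj V \<rho>) = 2 * ((1 - a ^ m) / 2)"
    by (simp only: diamond_norm_ctrl_conj_diff[OF V c])
  then show ?thesis
    by (simp add: em u_def V_def)
qed

end
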